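(* Consider the following directed graphs, in each of which every node additionally carries a self-loop, and the marked edge $\alpha$: (a) cause and effect: nodes $H,Y$; edge $H\to Y$; $\alpha=(H\to Y)$. (b) chain: nodes $H,X,Y$; edges $H\to X$, $X\to Y$; $\alpha=(X\to Y)$. (c) confounding: nodes $H,X,Y$; edges $H\to X$, $H\to Y$, $X\to Y$; $\alpha=(X\to Y)$. (d) cycle of length 3: nodes $H,X,Y$; edges $X\to H$, $H\to Y$, $Y\to X$; $\alpha=(H\to Y)$. (e) instrumental variable: nodes $Z,H,X,Y$; edges $Z\to X$, $H\to X$, $H\to Y$, $X\to Y$; $\alpha=(X\to Y)$. (f) cycle with instrumental variable: nodes $Z,H,X,Y$; edges $Z\to X$, $H\to X$, $Y\to H$, $X\to Y$; $\alpha=(X\to Y)$. Then (with all variables observed) the sign of $\alpha$ is partially identifiable for the graphs (c) and (d), and identifiable for the graphs (a), (b), (e) and (f).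
   Context: Let $PD_d$ be the set of symmetric positive definite real $d\times d$ matrices and $PDD_d\subset PD_d$ the set of diagonal ones. $G=(V,E)$ is a finite directed graph with $V=\{V_1,\dots,V_d\}$; cycles and self-loops are allowed. $\operatorname{An}_G(V_i)$ is the set of all $V_k$ from which there is a directed path with at least one edge to $V_i$ (so $V_i\in \operatorname{An}_G(V_i)$ iff $V_i$ lies on a directed cycle, a self-loop counting as a cycle). For $A\in\mathbb{R}^{d\times d}$ the entry $A_{ij}$ corresponds to the edge $e=(V_j,V_i)$, i.e. $V_j\to V_i$, and we write $A_e:=A_{ij}$; $\operatorname{supp}(A)$ is the set of edges $(V_j,V_i)$ with $A_{ij}\neq 0$. The set of $t$-faithful covariance matrices is $$F_G:=\{\Sigma\in PD_d:\ \forall V_i,V_j\in V,\ \operatorname{An}_G(V_i)\cap\operatorname{An}_G(V_j)=\emptyset\iff\Sigma_{ij}=0\}.$$ For $k\in\{+,-\}$, $$\mathcal{M}^{k}_{G,e}:=\{\Sigma\in F_G:\exists A\in\mathbb{R}^{d\times d},\,D\in PDD_d \text{ with } A\Sigma+\Sigma A^T=-D,\ \operatorname{supp}(A)=E,\ \operatorname{sign}(A_e)=k\}.$$ The sign of $e$ in $G$ is called: - non-identifiable if $\mathcal{M}^{+}_{G,e}=\mathcal{M}^{-}_{G,e}\neq\emptyset$; - partially identifiable if $\mathcal{M}^{+}_{G,e}\neq\mathcal{M}^{-}_{G,e}$ and $\mathcal{M}^{+}_{G,e}\cap\mathcal{M}^{-}_{G,e}\neq\emptyset$; - identifiable if $\mathcal{M}^{+}_{G,e}\cap\mathcal{M}^{-}_{G,e}=\emptyset$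 and at least one of $\mathcal{M}^{+}_{G,e},\mathcal{M}^{-}_{G,e}$ is non-empty. *)

theory Defs
  imports "HOL-Analysis.Analysis"
begin

definition PD :: "(real^'n^'n) set" where
  "PD = {S. transpose S = S \<and> (\<forall>x. x \<noteq> 0 \<longrightarrow> x \<bullet> (S *v x) > 0)}"

definition PDD :: "(real^'n^'n) set" where
  "PDD = {D \<in> PD. \<forall>i j. i \<noteq> j \<longrightarrow> D $ i $ j = 0}"

text \<open>A directed graph on the vertex set \<open>UNIV :: 'n set\<close> is its edge relation; the pair
  \<open>(u, v)\<close> is the edge from \<open>u\<close> to \<open>v\<close>. Paths defining ancestors have at least one edge.\<close>

definition An :: "'n rel \<Rightarrow> 'n \<Rightarrow> 'n set" where
  "An G v = {u. (u, v) \<in> G\<^sup>+}"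

text \<open>The edge from \<open>u\<close> to \<open>v\<close> carries the matrix entry in row \<open>v\<close> and column \<open>u\<close>.\<close>

definition edge_entry :: "real^'n^'n \<Rightarrow> 'n \<times> 'n \<Rightarrow> real" where
  "edge_entry A e = A $ snd e $ fst e"

definition supp :: "real^'n^'n \<Rightarrow> 'n rel" where
  "supp A = {e. edge_entry A e \<noteq> 0}"

definition faithful_cov :: "('n::finite) rel \<Rightarrow> (real^'n^'n) set" where
  "faithful_cov G = {S \<in> PD. \<forall>i j. An G i \<inter> An G j = {} \<longleftrightarrow> S $ i $ j = 0}"

text \<open>The sign \<open>k\<close> is encoded as \<open>1\<close> or \<open>-1\<close>.\<close>

definition sign_model :: "real \<Rightarrow> ('n::finite) rel \<Rightarrow> 'n \<times> 'n \<Rightarrow> (real^'n^'n) set" where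
  "sign_model k G e = {S \<in> faithful_cov G.
     \<exists>A D. D \<in> PDD \<and> A ** S + S ** transpose A = - D \<and> supp A = G \<and> sgn (edge_entry A e) = k}"

abbreviation M_plus :: "('n::finite) rel \<Rightarrow> 'n \<times> 'n \<Rightarrow> (real^'n^'n) set" where
  "M_plus \<equiv> sign_model 1"

abbreviation M_minus :: "('n::finite) rel \<Rightarrow> 'n \<times> 'n \<Rightarrow> (real^'n^'n) set" where
  "M_minus \<equiv> sign_model (-1)"

definition partially_identifiable :: "('n::finite) rel \<Rightarrow> 'n \<times> 'n \<Rightarrow> bool" where
  "partially_identifiable G e \<longleftrightarrow> M_plus G e \<noteq> M_minus G e \<and> M_plus G e \<inter> M_minus G e \<noteq> {}"

definition identifiable :: "('n::finite) rel \<Rightarrow> 'n \<times> 'n \<Rightarrow> bool" where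
  "identifiable G e \<longleftrightarrow>
     M_plus G e \<inter> M_minus G e = {} \<and> (M_plus G e \<noteq> {} \<or> M_minus G e \<noteq> {})"

text \<open>The suffix of a constructor is the number of nodes of its type.\<close>

datatype node2 = H2 | Y2
datatype node3 = H3 | X3 | Y3
datatype node4 = Z4 | H4 | X4 | Y4

lemma UNIV_node2: "UNIV = {H2, Y2}"
  using node2.exhaust by blast

lemma UNIV_node3: "UNIV = {H3, X3, Y3}"
  using node3.exhaust by blast

lemma UNIV_node4: "UNIV = {Z4, H4, X4, Y4}"
  using node4.exhaust by blast

instance node2 :: finite
  by standard (simp add: UNIV_node2)

instance node3 :: finite
  by standard (simp add: UNIV_node3)

instance node4 :: finite
  by standard (simp add: UNIV_node4)

definition cause_effect :: "node2 rel" where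
  "cause_effect = {(H2, Y2)} \<union> Id"

definition chain :: "node3 rel" where
  "chain = {(H3, X3), (X3, Y3)} \<union> Id"

definition confounding :: "node3 rel" where
  "confounding = {(H3, X3), (H3, Y3), (X3, Y3)} \<union> Id"

definition cycle3 :: "node3 rel" where
  "cycle3 = {(X3, H3), (H3, Y3), (Y3, X3)} \<union> Id"

definition instrumental :: "node4 rel" where
  "instrumental = {(Z4, X4), (H4, X4), (H4, Y4), (X4, Y4)} \<union> Id"

definition cycle_instrumental :: "node4 rel" where
  "cycle_instrumental = {(Z4, X4), (H4, X4), (Y4, H4), (X4, Y4)} \<union> Id"

end

theory Submission
  imports Defs
begin

text \<open>Membership in a sign model is a question about the single matrix \<open>M = A ** S\<close>: since \<open>S\<close> is
  symmetric, \<open>S ** transpose A\<close> is the transpose of \<open>M\<close>, so the Lyapunov equation has a solution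
  \<open>D\<close> exactly when \<open>M\<close> is antisymmetric off the diagonal and negative on it. For fixed \<open>S\<close> these
  are linear conditions on \<open>A\<close>.

  \<^emph>\<open>Identifiability.\<close> Let \<open>x\<close> be the tail and \<open>y\<close> the head of the marked edge. Let \<open>s\<close> be a vertex
  whose only parent is itself and which has zero covariance with all parents of \<open>y\<close> except
  possibly \<open>x\<close> and \<open>y\<close>. The \<open>(s, y)\<close> equation is then the instrumental variable relation
  \<open>A\<^sub>y\<^sub>x S\<^sub>s\<^sub>x = - (A\<^sub>s\<^sub>s + A\<^sub>y\<^sub>y) S\<^sub>s\<^sub>y\<close>, where \<open>A\<^sub>s\<^sub>s < 0\<close>
  (\<open>instrument_equation\<close>). If \<open>y\<close> is a sink, then \<open>A\<^sub>y\<^sub>y\<close> is a real eigenvalue of \<open>A\<close>, hence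
  negative, and the sign of \<open>A\<^sub>y\<^sub>x\<close> is that of \<open>S\<^sub>s\<^sub>x S\<^sub>s\<^sub>y\<close> (\<open>instrument_sink_sign\<close>). This
  covers cause and effect, the chain and the instrumental variable. In the cycle with an
  instrumental variable \<open>y\<close> is not a sink, but \<open>x\<close> is its only parent besides itself;
  eliminating \<open>A\<^sub>y\<^sub>y\<close> from the instrumental relation and the \<open>(y, y)\<close> inequality again
  expresses the sign of \<open>A\<^sub>y\<^sub>x\<close> through \<open>S\<close> (\<open>instrument_single_parent_sign\<close>).

  \<^emph>\<open>Partial identifiability.\<close> For confounding and for the 3-cycle, the off-diagonal equations
  express the marked weight as a linear combination of the three self-loop weights, with
  coefficients depending on \<open>S\<close>. If these coefficients have mixed signs, the marked weight can
  change sign when the relative sizes of the negative self-loop weights change, and some \<open>S\<close>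
  admits both signs. If the coefficients have the same sign, there are \<open>S\<close> for which the negative
  diagonal of \<open>M\<close> forces the sign of the edge. One explicit \<open>S\<close> of each kind suffices.\<close>

section \<open>Lyapunov equations with diagonal noise\<close>

lemma PD_symmetric: "S \<in> PD \<Longrightarrow> S $ i $ j = S $ j $ i"
  unfolding PD_def by (metis (mono_tags, lifting) mem_Collect_eq transpose_def vec_lambda_beta)

lemma PD_diagonal_pos:
  assumes "S \<in> PD"
  shows "S $ i $ i > 0"
proof -
  have "axis i 1 \<bullet> (S *v axis i 1) > 0"
    using assms by (simp add: PD_def axis_eq_0_iff)
  then show ?thesis
    by (simp add: matrix_vector_mul_component inner_axis' inner_axis)
qed

text \<open>Positive definiteness of the witnesses is read off their entries: by
  \<open>2 \<bar>u v\<bar> \<le> u\<^sup>2 + v\<^sup>2\<close>, each off-diagonal term of the quadratic form is absorbed by the two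
  diagonal terms in its row and its column.\<close>

lemma diagonally_dominant_imp_PD:
  fixes S :: "real^'n::finite^'n"
  assumes "\<forall>i j. S $ i $ j = S $ j $ i"
    and "\<forall>i. 2 * S $ i $ i > (\<Sum>j\<in>UNIV. \<bar>S $ i $ j\<bar>)"
  shows "S \<in> PD"
proof -
  have sym: "S $ i $ j = S $ j $ i" and dom: "2 * S $ i $ i > (\<Sum>j\<in>UNIV. \<bar>S $ i $ j\<bar>)" for i j
    using assms by blast+
  have pos: "x \<bullet> (S *v x) > 0" if x: "x \<noteq> 0" for x
  proof -
    have dpos: "S $ i $ i > 0" for i
    proof -
      have "(\<Sum>j\<in>UNIV. \<bar>S $ i $ j\<bar>) \<ge> 0" by (simp add: sum_nonneg)
      with dom[of i] show ?thesis by linarith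
    qed
    let ?b = "\<lambda>i j. \<bar>S $ i $ j\<bar> * ((x $ i)\<^sup>2 + (x $ j)\<^sup>2) / 2"
    \<comment> \<open>\<open>?b i i\<close> is the diagonal term itself, which the full double sum of \<open>?b\<close> subtracts once
      too often; hence the factor 2 on the diagonal.\<close>
    have summand: "S $ i $ j * x $ i * x $ j \<ge> (if i = j then 2 * S $ i $ i * (x $ i)\<^sup>2 else 0) - ?b i j"
      for i j
    proof (cases "i = j")
      case True
      then show ?thesis using dpos[of i] by (simp add: power2_eq_square)
    next
      case False
      have "\<bar>x $ i * x $ j\<bar> \<le> ((x $ i)\<^sup>2 + (x $ j)\<^sup>2) / 2"
        using sum_squares_bound[of "\<bar>x $ i\<bar>" "\<bar>x $ j\<bar>"] by (simp add: abs_mult)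
      then have "\<bar>S $ i $ j\<bar> * \<bar>x $ i * x $ j\<bar> \<le> ?b i j"
        using mult_left_mono[of _ _ "\<bar>S $ i $ j\<bar>"] by fastforce
      then have "\<bar>S $ i $ j * x $ i * x $ j\<bar> \<le> ?b i j"
        by (simp add: abs_mult mult.assoc)
      then show ?thesis using False by simp
    qed
    have sym_sum: "(\<Sum>i\<in>UNIV. \<Sum>j\<in>UNIV. \<bar>S $ i $ j\<bar> * (x $ j)\<^sup>2)
        = (\<Sum>i\<in>UNIV. \<Sum>j\<in>UNIV. \<bar>S $ i $ j\<bar> * (x $ i)\<^sup>2)"
      by (subst sum.swap) (simp add: sym)
    have b_sum: "(\<Sum>i\<in>UNIV. \<Sum>j\<in>UNIV. ?b i j) = (\<Sum>i\<in>UNIV. \<Sum>j\<in>UNIV. \<bar>S $ i $ j\<bar> * (x $ i)\<^sup>2)"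
      using sym_sum by (simp add: distrib_left add_divide_distrib sum.distrib sum_divide_distrib[symmetric])
    obtain k where k: "x $ k \<noteq> 0" using x by (auto simp: vec_eq_iff)
    have "0 < (\<Sum>i\<in>UNIV. (2 * S $ i $ i - (\<Sum>j\<in>UNIV. \<bar>S $ i $ j\<bar>)) * (x $ i)\<^sup>2)"
      by (rule sum_pos2[of _ k]) (use k dom in \<open>auto simp: less_imp_le\<close>)
    also have "\<dots> = (\<Sum>i\<in>UNIV. \<Sum>j\<in>UNIV. (if i = j then 2 * S $ i $ i * (x $ i)\<^sup>2 else 0) - ?b i j)"
      unfolding sum_subtractf b_sum
      by (simp add: left_diff_distrib sum_subtractf sum_distrib_right)
    also have "\<dots> \<le> (\<Sum>i\<in>UNIV. \<Sum>j\<in>UNIV. S $ i $ j * x $ i * x $ j)"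
      by (intro sum_mono summand)
    also have "\<dots> = x \<bullet> (S *v x)"
      by (simp add: inner_vec_def matrix_vector_mult_def sum_distrib_left mult_ac)
    finally show ?thesis .
  qed
  have "transpose S = S" using sym by (simp add: transpose_def vec_eq_iff)
  with pos show ?thesis by (simp add: PD_def)
qed

lemma diagonal_imp_PDD:
  fixes D :: "real^'n::finite^'n"
  assumes "\<And>i j. i \<noteq> j \<Longrightarrow> D $ i $ j = 0" "\<And>i. D $ i $ i > 0"
  shows "D \<in> PDD"
proof -
  have "(\<Sum>j\<in>UNIV. \<bar>D $ i $ j\<bar>) = D $ i $ i" for i
  proof -
    have "(\<Sum>j\<in>UNIV. \<bar>D $ i $ j\<bar>) = (\<Sum>j\<in>{i}. \<bar>D $ i $ j\<bar>)"
      by (rule sum.mono_neutral_right) (use assms(1) in auto)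
    then show ?thesis using assms(2)[of i] by simp
  qed
  then have "D \<in> PD"
    using assms by (intro diagonally_dominant_imp_PD) (auto, metis)
  with assms show ?thesis by (simp add: PDD_def)
qed

lemma matrix_mult_transpose_nth:
  assumes "S \<in> PD"
  shows "(S ** transpose A) $ i $ j = (A ** S) $ j $ i"
  using PD_symmetric[OF assms]
  by (simp add: matrix_matrix_mult_def transpose_def mult.commute)

lemma lyapunov_diagonal_iff:
  assumes S: "S \<in> PD"
  shows "(\<exists>D \<in> PDD. A ** S + S ** transpose A = - D) \<longleftrightarrow>
    (\<forall>i j. i \<noteq> j \<longrightarrow> (A ** S) $ i $ j + (A ** S) $ j $ i = 0) \<and> (\<forall>i. (A ** S) $ i $ i < 0)"
    (is "?L \<longleftrightarrow> ?R")
proof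
  assume ?L
  then obtain D where D: "D \<in> PDD" and eq: "A ** S + S ** transpose A = - D" by blast
  have entry: "(A ** S) $ i $ j + (A ** S) $ j $ i = - D $ i $ j" for i j
    using arg_cong[OF eq, of "\<lambda>M. M $ i $ j"] by (simp add: matrix_mult_transpose_nth[OF S])
  have "(A ** S) $ i $ i < 0" for i
    using entry[of i i] PD_diagonal_pos[of D i] D by (simp add: PDD_def)
  with entry D show ?R by (simp add: PDD_def)
next
  assume R: ?R
  let ?D = "- (A ** S + S ** transpose A)"
  have "?D \<in> PDD"
  proof (rule diagonal_imp_PDD)
    show "?D $ i $ j = 0" if "i \<noteq> j" for i j
      using R that by (simp add: matrix_mult_transpose_nth[OF S] neg_eq_iff_add_eq_0)
    show "?D $ i $ i > 0" for i
      using R by (simp add: matrix_mult_transpose_nth[OF S] add_neg_neg)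
  qed
  then show ?L by (intro bexI[of _ ?D]) simp_all
qed

lemma supp_eq_iff: "supp A = G \<longleftrightarrow> (\<forall>i j. A $ i $ j = 0 \<longleftrightarrow> (j, i) \<notin> G)"
  by (auto simp: supp_def edge_entry_def set_eq_iff)

lemma sign_model_iff:
  "S \<in> sign_model k G (u, v) \<longleftrightarrow> S \<in> faithful_cov G \<and>
    (\<exists>A. (\<forall>i j. i \<noteq> j \<longrightarrow> (A ** S) $ i $ j + (A ** S) $ j $ i = 0) \<and>
      (\<forall>i. (A ** S) $ i $ i < 0) \<and>
      (\<forall>i j. A $ i $ j = 0 \<longleftrightarrow> (j, i) \<notin> G) \<and> sgn (A $ v $ u) = k)"
proof (cases "S \<in> PD")
  case True
  have "S \<in> sign_model k G (u, v) \<longleftrightarrow> S \<in> faithful_cov G \<and>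
    (\<exists>A. (\<exists>D \<in> PDD. A ** S + S ** transpose A = - D) \<and> supp A = G \<and> sgn (A $ v $ u) = k)"
    by (auto simp: sign_model_def edge_entry_def)
  then show ?thesis
    unfolding lyapunov_diagonal_iff[OF True] supp_eq_iff by (simp only: conj_assoc)
next
  case False
  then show ?thesis by (simp add: sign_model_def faithful_cov_def)
qed

section \<open>Faithfulness\<close>

lemma ancestor_of_parent: "(u, v) \<in> G \<Longrightarrow> An G u \<subseteq> An G v"
  by (auto simp: An_def intro: trancl.trancl_into_trancl)

lemma parent_is_ancestor: "(u, v) \<in> G \<Longrightarrow> u \<in> An G v"
  by (auto simp: An_def)

lemma source_An:
  assumes "\<And>u. (u, s) \<in> G \<longleftrightarrow> u = s"
  shows "An G s = {s}"
proof -
  have "u = s" if "(u, s) \<in> G\<^sup>+" for u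
    using that by (induction rule: converse_trancl_induct) (use assms in auto)
  then show ?thesis using assms by (auto simp: An_def)
qed

lemma faithful_cov_rooted:
  assumes "\<And>v. r \<in> An G v"
  shows "S \<in> faithful_cov G \<longleftrightarrow> S \<in> PD \<and> (\<forall>i j. S $ i $ j \<noteq> 0)"
  using assms by (fastforce simp: faithful_cov_def)

section \<open>Sign criteria\<close>

text \<open>With \<open>w = S\<^sup>-\<^sup>1 v\<close>, the form \<open>w \<bullet> (A ** S) w = c (w \<bullet> S w)\<close> only sees the diagonal of
  \<open>A ** S\<close>, because the off-diagonal part is antisymmetric.\<close>

lemma real_eigenvalue_neg:
  fixes A S :: "real^'n::finite^'n"
  assumes S: "S \<in> PD"
    and off: "\<And>i j. i \<noteq> j \<Longrightarrow> (A ** S) $ i $ j + (A ** S) $ j $ i = 0"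
    and diag: "\<And>i. (A ** S) $ i $ i < 0"
    and v: "v \<noteq> 0" "A *v v = c *\<^sub>R v"
  shows "c < 0"
proof -
  have "invertible S"
    unfolding invertible_left_inverse matrix_left_invertible_ker
    using S by (force simp: PD_def)
  then obtain T where "S ** T = mat 1" by (auto simp: invertible_def)
  then have w: "S *v (T *v v) = v" by (simp add: matrix_vector_mul_assoc)
  define w where "w = T *v v"
  have Sw: "S *v w = v" and "w \<noteq> 0"
    using w v(1) by (auto simp: w_def matrix_vector_mult_0_right)
  let ?M = "A ** S"
  have "w \<bullet> (?M *v w) = (\<Sum>i\<in>UNIV. \<Sum>j\<in>UNIV. ?M $ i $ j * w $ i * w $ j)"
    by (simp add: inner_vec_def matrix_vector_mult_def sum_distrib_left mult_ac)
  moreover have "\<dots> = (\<Sum>i\<in>UNIV. \<Sum>j\<in>UNIV. ?M $ j $ i * w $ i * w $ j)"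
    by (subst sum.swap) (simp add: mult_ac)
  ultimately have "2 * (w \<bullet> (?M *v w))
      = (\<Sum>i\<in>UNIV. \<Sum>j\<in>UNIV. (?M $ i $ j + ?M $ j $ i) * w $ i * w $ j)"
    by (simp add: distrib_right sum.distrib)
  also have "\<dots> = (\<Sum>i\<in>UNIV. \<Sum>j\<in>UNIV. if j = i then 2 * ?M $ i $ i * (w $ i)\<^sup>2 else 0)"
    by (intro sum.cong refl) (use off in \<open>auto simp: power2_eq_square\<close>)
  also have "\<dots> = - (\<Sum>i\<in>UNIV. - 2 * ?M $ i $ i * (w $ i)\<^sup>2)"
    by (simp add: sum_negf)
  also have "\<dots> < 0"
  proof -
    obtain k where "w $ k \<noteq> 0" using \<open>w \<noteq> 0\<close> by (auto simp: vec_eq_iff)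
    then have "(\<Sum>i\<in>UNIV. - 2 * ?M $ i $ i * (w $ i)\<^sup>2) > 0"
      using diag by (intro sum_pos2[of _ k]) (auto simp: mult_neg_pos mult_nonpos_nonneg less_imp_le)
    then show ?thesis by simp
  qed
  finally have "w \<bullet> (?M *v w) < 0" by simp
  also have "w \<bullet> (?M *v w) = c * (w \<bullet> (S *v w))"
    by (simp add: matrix_vector_mul_assoc[symmetric] Sw v(2))
  finally show ?thesis
    using S \<open>w \<noteq> 0\<close> by (auto simp: PD_def mult_less_0_iff dest: order.asym)
qed

text \<open>A self-loop weight at a sink is an eigenvalue for the corresponding unit vector.\<close>

lemma sink_self_loop_neg:
  fixes A S :: "real^'n::finite^'n"
  assumes "S \<in> PD"
    and "\<And>i j. i \<noteq> j \<Longrightarrow> (A ** S) $ i $ j + (A ** S) $ j $ i = 0"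
    and "\<And>i. (A ** S) $ i $ i < 0"
    and sink: "\<And>i. i \<noteq> y \<Longrightarrow> A $ i $ y = 0"
  shows "A $ y $ y < 0"
proof (rule real_eigenvalue_neg[OF assms(1-3)])
  show "axis y 1 \<noteq> (0 :: real^'n)" by (simp add: axis_eq_0_iff)
  show "A *v axis y 1 = A $ y $ y *\<^sub>R axis y 1"
    unfolding matrix_vector_mult_basis using sink by (auto simp: vec_eq_iff column_def axis_def)
qed

lemma source_row_mult:
  fixes A S :: "real^'n::finite^'n"
  assumes "\<And>k. k \<noteq> s \<Longrightarrow> A $ s $ k = 0"
  shows "(A ** S) $ s $ j = A $ s $ s * S $ s $ j"
proof -
  have "(\<Sum>k\<in>UNIV. A $ s $ k * S $ k $ j) = (\<Sum>k\<in>{s}. A $ s $ k * S $ k $ j)"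
    by (rule sum.mono_neutral_right) (use assms in auto)
  then show ?thesis by (simp add: matrix_matrix_mult_def)
qed

lemma source_self_loop_neg:
  fixes A S :: "real^'n::finite^'n"
  assumes "S \<in> PD" "(A ** S) $ s $ s < 0" "\<And>k. k \<noteq> s \<Longrightarrow> A $ s $ k = 0"
  shows "A $ s $ s < 0"
  using assms(2) source_row_mult[of s A, OF assms(3)] PD_diagonal_pos[OF assms(1), of s]
  by (simp add: mult_less_0_iff)

text \<open>The \<open>(s, y)\<close> entry of the Lyapunov equation: a source \<open>s\<close> that is uncorrelated with every
  further cause of \<open>y\<close> acts as an instrument for the effect of \<open>x\<close> on \<open>y\<close>. The case \<open>s = x\<close> is
  included.\<close>

lemma instrument_equation:
  fixes A S :: "real^'n::finite^'n"
  assumes S: "S \<in> PD"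
    and off: "(A ** S) $ s $ y + (A ** S) $ y $ s = 0"
    and source: "\<And>k. k \<noteq> s \<Longrightarrow> A $ s $ k = 0"
    and "x \<noteq> y"
    and instr: "\<And>k. k \<noteq> x \<Longrightarrow> k \<noteq> y \<Longrightarrow> A $ y $ k * S $ s $ k = 0"
  shows "A $ y $ x * S $ s $ x = - (A $ s $ s + A $ y $ y) * S $ s $ y"
proof -
  have "(\<Sum>k\<in>UNIV. A $ y $ k * S $ k $ s) = (\<Sum>k\<in>{x, y}. A $ y $ k * S $ k $ s)"
    by (rule sum.mono_neutral_right) (use instr PD_symmetric[OF S, of _ s] in auto)
  then have "(A ** S) $ y $ s = (\<Sum>k\<in>{x, y}. A $ y $ k * S $ k $ s)"
    by (simp add: matrix_matrix_mult_def)
  with off source_row_mult[of s A S y] source \<open>x \<noteq> y\<close> show ?thesis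
    by (simp add: PD_symmetric[OF S, of _ s] algebra_simps)
qed

lemma sgn_eq_if_mult_pos: "a * b > 0 \<Longrightarrow> sgn a = sgn (b :: real)"
  by (auto simp: zero_less_mult_iff)

text \<open>The factor \<open>A\<^sub>s\<^sub>s + A\<^sub>y\<^sub>y\<close> of the instrument equation is negative, since both self-loop
  weights are.\<close>

lemma instrument_sink_sign:
  fixes A S :: "real^'n::finite^'n"
  assumes S: "S \<in> PD"
    and off: "\<And>i j. i \<noteq> j \<Longrightarrow> (A ** S) $ i $ j + (A ** S) $ j $ i = 0"
    and diag: "\<And>i. (A ** S) $ i $ i < 0"
    and source: "\<And>k. k \<noteq> s \<Longrightarrow> A $ s $ k = 0"
    and sink: "\<And>k. k \<noteq> y \<Longrightarrow> A $ k $ y = 0"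
    and "s \<noteq> y" "x \<noteq> y"
    and instr: "\<And>k. k \<noteq> x \<Longrightarrow> k \<noteq> y \<Longrightarrow> A $ y $ k * S $ s $ k = 0"
    and nz: "S $ s $ y \<noteq> 0"
  shows "sgn (A $ y $ x) = sgn (S $ s $ x * S $ s $ y)"
proof -
  define b where "b = A $ s $ s + A $ y $ y"
  have "A $ y $ x * S $ s $ x = - b * S $ s $ y"
    unfolding b_def using instrument_equation[OF S off source] assms by blast
  then have "A $ y $ x * (S $ s $ x * S $ s $ y) = - b * (S $ s $ y)\<^sup>2"
    by (simp add: power2_eq_square flip: mult.assoc)
  moreover have "b < 0"
    unfolding b_def
    using source_self_loop_neg[OF S diag source] sink_self_loop_neg[OF S off diag sink] by force
  ultimately show ?thesis
    using nz by (intro sgn_eq_if_mult_pos) (simp add: mult_neg_pos)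
qed

text \<open>If \<open>x\<close> is the only parent of \<open>y\<close> besides \<open>y\<close>, the \<open>(y, y)\<close> inequality
  \<open>A\<^sub>y\<^sub>x S\<^sub>x\<^sub>y + A\<^sub>y\<^sub>y S\<^sub>y\<^sub>y < 0\<close> replaces the information on \<open>A\<^sub>y\<^sub>y\<close>: multiplied by \<open>S\<^sub>s\<^sub>y\<^sup>2\<close> and
  with \<open>A\<^sub>y\<^sub>y S\<^sub>s\<^sub>y\<close> eliminated through the instrument equation it becomes
  \<open>A\<^sub>y\<^sub>x S\<^sub>s\<^sub>y (S\<^sub>y\<^sub>y S\<^sub>s\<^sub>x - S\<^sub>x\<^sub>y S\<^sub>s\<^sub>y) > - A\<^sub>s\<^sub>s S\<^sub>y\<^sub>y S\<^sub>s\<^sub>y\<^sup>2 > 0\<close>. This leaves \<open>y\<close> free to be a cause of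
  \<open>x\<close>.\<close>

lemma instrument_single_parent_sign:
  fixes A S :: "real^'n::finite^'n"
  assumes S: "S \<in> PD"
    and off: "(A ** S) $ s $ y + (A ** S) $ y $ s = 0"
    and diag: "\<And>i. (A ** S) $ i $ i < 0"
    and source: "\<And>k. k \<noteq> s \<Longrightarrow> A $ s $ k = 0"
    and "x \<noteq> y"
    and parents: "\<And>k. k \<noteq> x \<Longrightarrow> k \<noteq> y \<Longrightarrow> A $ y $ k = 0"
    and nz: "S $ s $ y \<noteq> 0"
  shows "sgn (A $ y $ x) = sgn (S $ s $ y * (S $ y $ y * S $ s $ x - S $ x $ y * S $ s $ y))"
proof -
  define a c \<alpha> p q r t where defs: "a = A $ s $ s" "c = A $ y $ y" "\<alpha> = A $ y $ x"
    "p = S $ s $ x" "q = S $ s $ y" "r = S $ x $ y" "t = S $ y $ y"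
  have eq: "\<alpha> * p = - (a + c) * q"
    unfolding defs using instrument_equation[OF S off source \<open>x \<noteq> y\<close>] parents by simp
  have "(\<Sum>k\<in>UNIV. A $ y $ k * S $ k $ y) = (\<Sum>k\<in>{x, y}. A $ y $ k * S $ k $ y)"
    by (rule sum.mono_neutral_right) (use parents in auto)
  then have "(A ** S) $ y $ y = (\<Sum>k\<in>{x, y}. A $ y $ k * S $ k $ y)"
    by (simp add: matrix_matrix_mult_def)
  then have yy: "\<alpha> * r + c * t < 0"
    using diag[of y] \<open>x \<noteq> y\<close> by (simp add: defs)
  have "a < 0" "t > 0" "q \<noteq> 0"
    using source_self_loop_neg[OF S diag source] PD_diagonal_pos[OF S] nz by (simp_all add: defs)
  then have "a * (t * q\<^sup>2) < 0" by (simp add: mult_neg_pos)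
  moreover have "(\<alpha> * r + c * t) * q\<^sup>2 < 0"
    using yy \<open>q \<noteq> 0\<close> by (simp add: mult_neg_pos)
  moreover have "\<alpha> * (q * (t * p - r * q)) = - a * (t * q\<^sup>2) - (\<alpha> * r + c * t) * q\<^sup>2"
    using eq by algebra
  ultimately have "\<alpha> * (q * (t * p - r * q)) > 0" by linarith
  then show ?thesis
    unfolding defs[symmetric] by (rule sgn_eq_if_mult_pos)
qed

text \<open>If the sign of the edge weight is a function \<open>f\<close> of \<open>S\<close> alone, then no \<open>S\<close> lies in both
  models; \<open>S\<^sub>0\<close> shows that they are not both empty.\<close>

lemma identifiableI:
  assumes "\<And>A S. S \<in> faithful_cov G \<Longrightarrow>
      (\<And>i j. i \<noteq> j \<Longrightarrow> (A ** S) $ i $ j + (A ** S) $ j $ i = 0) \<Longrightarrow>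
      (\<And>i. (A ** S) $ i $ i < 0) \<Longrightarrow>
      (\<And>i j. A $ i $ j = 0 \<longleftrightarrow> (j, i) \<notin> G) \<Longrightarrow> sgn (A $ v $ u) = f S"
    and "S\<^sub>0 \<in> M_plus G (u, v) \<or> S\<^sub>0 \<in> M_minus G (u, v)"
  shows "identifiable G (u, v)"
proof -
  have "f S = k" if "S \<in> sign_model k G (u, v)" for k S
  proof -
    from that obtain A where "S \<in> faithful_cov G"
      and "\<And>i j. i \<noteq> j \<Longrightarrow> (A ** S) $ i $ j + (A ** S) $ j $ i = 0"
      and "\<And>i. (A ** S) $ i $ i < 0"
      and "\<And>i j. A $ i $ j = 0 \<longleftrightarrow> (j, i) \<notin> G" and k: "sgn (A $ v $ u) = k"
      unfolding sign_model_iff by blast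
    from assms(1)[OF this(1-4)] k show ?thesis by simp
  qed
  from this[of _ 1] this[of _ "-1"] have "M_plus G (u, v) \<inter> M_minus G (u, v) = {}"
    by fastforce
  with assms(2) show ?thesis by (auto simp: identifiable_def)
qed

section \<open>Matrices on the concrete vertex types\<close>

definition vec2 :: "'a \<Rightarrow> 'a \<Rightarrow> 'a^node2" where
  "vec2 h y = (\<chi> i. case i of H2 \<Rightarrow> h | Y2 \<Rightarrow> y)"

definition vec3 :: "'a \<Rightarrow> 'a \<Rightarrow> 'a \<Rightarrow> 'a^node3" where
  "vec3 h x y = (\<chi> i. case i of H3 \<Rightarrow> h | X3 \<Rightarrow> x | Y3 \<Rightarrow> y)"

definition vec4 :: "'a \<Rightarrow> 'a \<Rightarrow> 'a \<Rightarrow> 'a \<Rightarrow> 'a^node4" where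
  "vec4 z h x y = (\<chi> i. case i of Z4 \<Rightarrow> z | H4 \<Rightarrow> h | X4 \<Rightarrow> x | Y4 \<Rightarrow> y)"

lemma vec_nth_simps [simp]:
  "vec2 a b $ H2 = a" "vec2 a b $ Y2 = b"
  "vec3 a b c $ H3 = a" "vec3 a b c $ X3 = b" "vec3 a b c $ Y3 = c"
  "vec4 a b c d $ Z4 = a" "vec4 a b c d $ H4 = b" "vec4 a b c d $ X4 = c" "vec4 a b c d $ Y4 = d"
  by (simp_all add: vec2_def vec3_def vec4_def)

lemma all_node2: "(\<forall>i. P i) \<longleftrightarrow> P H2 \<and> P Y2"
  by (metis node2.exhaust)

lemma all_node3: "(\<forall>i. P i) \<longleftrightarrow> P H3 \<and> P X3 \<and> P Y3"
  by (metis node3.exhaust)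

lemma all_node4: "(\<forall>i. P i) \<longleftrightarrow> P Z4 \<and> P H4 \<and> P X4 \<and> P Y4"
  by (metis node4.exhaust)

lemma sum_node2: "sum f (UNIV :: node2 set) = f H2 + f Y2"
  by (simp add: UNIV_node2)

lemma sum_node3: "sum f (UNIV :: node3 set) = f H3 + f X3 + f Y3"
  by (simp add: UNIV_node3 add.assoc)

lemma sum_node4: "sum f (UNIV :: node4 set) = f Z4 + f H4 + f X4 + f Y4"
  by (simp add: UNIV_node4 add.assoc)

lemmas node_simps = all_node2 all_node3 all_node4 sum_node2 sum_node3 sum_node4
  matrix_matrix_mult_def

section \<open>The identifiable graphs\<close>

text \<open>In cause and effect and in the chain the root \<open>H\<close> is the instrument. The explicit members of
  the models have variances that exceed the sum of the absolute covariances in each row, so that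
  diagonal dominance applies. Except in the last graph they arise by setting all self-loop weights
  to \<open>-1\<close> and solving the off-diagonal equations vertex by vertex along the order of the graph; in
  the last graph \<open>S\<close> is chosen first and the equations are solved for \<open>A\<close>.\<close>

lemma cause_effect_faithful:
  "S \<in> faithful_cov cause_effect \<longleftrightarrow> S \<in> PD \<and> (\<forall>i j. S $ i $ j \<noteq> 0)"
proof (rule faithful_cov_rooted)
  show "H2 \<in> An cause_effect v" for v
    by (cases v) (auto intro: parent_is_ancestor simp: cause_effect_def)
qed

lemma cause_effect_identifiable: "identifiable cause_effect (H2, Y2)"
proof (rule identifiableI)
  fix A S :: "real^node2^node2"
  assume S: "S \<in> faithful_cov cause_effect"
    and off: "\<And>i j. i \<noteq> j \<Longrightarrow> (A ** S) $ i $ j + (A ** S) $ j $ i = 0"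
    and diag: "\<And>i. (A ** S) $ i $ i < 0"
    and supp: "\<And>i j. A $ i $ j = 0 \<longleftrightarrow> (j, i) \<notin> cause_effect"
  show "sgn (A $ Y2 $ H2) = sgn (S $ H2 $ H2 * S $ H2 $ Y2)"
  proof (rule instrument_sink_sign[OF _ off diag])
    show "A $ Y2 $ k * S $ H2 $ k = 0" if "k \<noteq> H2" "k \<noteq> Y2" for k
      using that by (cases k) auto
  qed (use S[unfolded cause_effect_faithful] supp in \<open>auto simp: cause_effect_def\<close>)
next
  let ?S = "vec2 (vec2 2 1) (vec2 1 2) :: real^node2^node2"
  let ?A = "vec2 (vec2 (-1) 0) (vec2 1 (-1)) :: real^node2^node2"
  have "?S \<in> M_plus cause_effect (H2, Y2)"
    unfolding sign_model_iff cause_effect_faithful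
    by (intro conjI diagonally_dominant_imp_PD exI[of _ ?A])
      (simp_all add: node_simps cause_effect_def)
  then show "?S \<in> M_plus cause_effect (H2, Y2) \<or> ?S \<in> M_minus cause_effect (H2, Y2)" ..
qed

lemma chain_faithful: "S \<in> faithful_cov chain \<longleftrightarrow> S \<in> PD \<and> (\<forall>i j. S $ i $ j \<noteq> 0)"
proof (rule faithful_cov_rooted)
  have "H3 \<in> An chain H3" "An chain H3 \<subseteq> An chain X3" "An chain X3 \<subseteq> An chain Y3"
    by (auto intro!: parent_is_ancestor ancestor_of_parent simp: chain_def)
  then show "H3 \<in> An chain v" for v by (cases v) auto
qed

lemma chain_identifiable: "identifiable chain (X3, Y3)"
proof (rule identifiableI)
  fix A S :: "real^node3^node3"
  assume S: "S \<in> faithful_cov chain"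
    and off: "\<And>i j. i \<noteq> j \<Longrightarrow> (A ** S) $ i $ j + (A ** S) $ j $ i = 0"
    and diag: "\<And>i. (A ** S) $ i $ i < 0"
    and supp: "\<And>i j. A $ i $ j = 0 \<longleftrightarrow> (j, i) \<notin> chain"
  show "sgn (A $ Y3 $ X3) = sgn (S $ H3 $ X3 * S $ H3 $ Y3)"
  proof (rule instrument_sink_sign[OF _ off diag])
    show "A $ Y3 $ k * S $ H3 $ k = 0" if "k \<noteq> X3" "k \<noteq> Y3" for k
      using that supp[of Y3 k] by (auto simp: chain_def)
  qed (use S[unfolded chain_faithful] supp in \<open>auto simp: chain_def\<close>)
next
  let ?S = "vec3 (vec3 16 8 2) (vec3 8 16 5) (vec3 2 5 16) :: real^node3^node3"
  let ?A = "vec3 (vec3 (-1) 0 0) (vec3 1 (-1) 0) (vec3 0 (1/2) (-1)) :: real^node3^node3"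
  have "?S \<in> M_plus chain (X3, Y3)"
    unfolding sign_model_iff chain_faithful
    by (intro conjI diagonally_dominant_imp_PD exI[of _ ?A])
      (simp_all add: node_simps chain_def)
  then show "?S \<in> M_plus chain (X3, Y3) \<or> ?S \<in> M_minus chain (X3, Y3)" ..
qed

lemma instrumental_faithful:
  "S \<in> faithful_cov instrumental \<longleftrightarrow> S \<in> PD \<and>
    (\<forall>i j. S $ i $ j = 0 \<longleftrightarrow> (i, j) \<in> {(Z4, H4), (H4, Z4)})"
proof -
  have Z: "An instrumental Z4 = {Z4}" and H: "An instrumental H4 = {H4}"
    by (rule source_An; auto simp: instrumental_def)+
  have X: "Z4 \<in> An instrumental X4" "H4 \<in> An instrumental X4"
    by (auto intro: parent_is_ancestor simp: instrumental_def)
  have "An instrumental X4 \<subseteq> An instrumental Y4"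
    by (rule ancestor_of_parent) (simp add: instrumental_def)
  with X have Y: "Z4 \<in> An instrumental Y4" "H4 \<in> An instrumental Y4" by auto
  have "An instrumental i \<inter> An instrumental j = {} \<longleftrightarrow> (i, j) \<in> {(Z4, H4), (H4, Z4)}" for i j
    using X Y by (cases i; cases j) (auto simp: Z H)
  then show ?thesis by (auto simp: faithful_cov_def)
qed

text \<open>The confounder \<open>H\<close> of \<open>X\<close> and \<open>Y\<close> does not disturb the instrument equation: faithfulness
  makes \<open>Z\<close> and \<open>H\<close> uncorrelated.\<close>

lemma instrumental_identifiable: "identifiable instrumental (X4, Y4)"
proof (rule identifiableI)
  fix A S :: "real^node4^node4"
  assume S: "S \<in> faithful_cov instrumental"
    and off: "\<And>i j. i \<noteq> j \<Longrightarrow> (A ** S) $ i $ j + (A ** S) $ j $ i = 0"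
    and diag: "\<And>i. (A ** S) $ i $ i < 0"
    and supp: "\<And>i j. A $ i $ j = 0 \<longleftrightarrow> (j, i) \<notin> instrumental"
  show "sgn (A $ Y4 $ X4) = sgn (S $ Z4 $ X4 * S $ Z4 $ Y4)"
  proof (rule instrument_sink_sign[OF _ off diag])
    show "A $ Y4 $ k * S $ Z4 $ k = 0" if "k \<noteq> X4" "k \<noteq> Y4" for k
      using that supp[of Y4 k] S[unfolded instrumental_faithful]
      by (cases k) (auto simp: instrumental_def)
  qed (use S[unfolded instrumental_faithful] supp in \<open>auto simp: instrumental_def\<close>)
next
  let ?S = "vec4 (vec4 16 0 4 1) (vec4 0 16 4 2) (vec4 4 4 16 5) (vec4 1 2 5 16) :: real^node4^node4"
  let ?A = "vec4 (vec4 (-1) 0 0 0) (vec4 0 (-1) 0 0) (vec4 (1/2) (1/2) (-1) 0)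
    (vec4 0 (1/8) (1/2) (-1)) :: real^node4^node4"
  have "?S \<in> M_plus instrumental (X4, Y4)"
    unfolding sign_model_iff instrumental_faithful
    by (intro conjI diagonally_dominant_imp_PD exI[of _ ?A])
      (simp_all add: node_simps instrumental_def)
  then show "?S \<in> M_plus instrumental (X4, Y4) \<or> ?S \<in> M_minus instrumental (X4, Y4)" ..
qed

lemma cycle_instrumental_faithful:
  "S \<in> faithful_cov cycle_instrumental \<longleftrightarrow> S \<in> PD \<and> (\<forall>i j. S $ i $ j \<noteq> 0)"
proof (rule faithful_cov_rooted)
  let ?G = cycle_instrumental
  have "Z4 \<in> An ?G Z4" "Z4 \<in> An ?G X4" "An ?G X4 \<subseteq> An ?G Y4" "An ?G Y4 \<subseteq> An ?G H4"
    by (auto intro!: parent_is_ancestor ancestor_of_parent simp: cycle_instrumental_def)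
  then show "Z4 \<in> An ?G v" for v by (cases v) auto
qed

lemma cycle_instrumental_identifiable: "identifiable cycle_instrumental (X4, Y4)"
proof (rule identifiableI)
  fix A S :: "real^node4^node4"
  assume S: "S \<in> faithful_cov cycle_instrumental"
    and off: "\<And>i j. i \<noteq> j \<Longrightarrow> (A ** S) $ i $ j + (A ** S) $ j $ i = 0"
    and diag: "\<And>i. (A ** S) $ i $ i < 0"
    and supp: "\<And>i j. A $ i $ j = 0 \<longleftrightarrow> (j, i) \<notin> cycle_instrumental"
  show "sgn (A $ Y4 $ X4) =
      sgn (S $ Z4 $ Y4 * (S $ Y4 $ Y4 * S $ Z4 $ X4 - S $ X4 $ Y4 * S $ Z4 $ Y4))"
    by (rule instrument_single_parent_sign[OF _ off diag])
      (use S[unfolded cycle_instrumental_faithful] supp in \<open>auto simp: cycle_instrumental_def\<close>)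
next
  let ?S = "vec4 (vec4 8 1 2 2) (vec4 1 8 (-2) 2) (vec4 2 (-2) 8 2) (vec4 2 2 2 8) :: real^node4^node4"
  let ?A = "vec4 (vec4 (-3) 0 0 0) (vec4 0 (-1) 0 2) (vec4 6 (-6) (-18) 0)
    (vec4 0 0 5 (-2)) :: real^node4^node4"
  have "?S \<in> M_plus cycle_instrumental (X4, Y4)"
    unfolding sign_model_iff cycle_instrumental_faithful
    by (intro conjI diagonally_dominant_imp_PD exI[of _ ?A])
      (simp_all add: node_simps cycle_instrumental_def)
  then show "?S \<in> M_plus cycle_instrumental (X4, Y4) \<or> ?S \<in> M_minus cycle_instrumental (X4, Y4)" ..
qed

section \<open>The partially identifiable graphs\<close>

lemma confounding_faithful:
  "S \<in> faithful_cov confounding \<longleftrightarrow> S \<in> PD \<and> (\<forall>i j. S $ i $ j \<noteq> 0)"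
proof (rule faithful_cov_rooted)
  show "H3 \<in> An confounding v" for v
    by (cases v) (auto intro: parent_is_ancestor simp: confounding_def)
qed

text \<open>Write \<open>a\<close>, \<open>b\<close>, \<open>c\<close> for the self-loop weights of \<open>H\<close>, \<open>X\<close>, \<open>Y\<close>, and \<open>p\<close>, \<open>q\<close>, \<open>r\<close> for
  \<open>S\<^sub>H\<^sub>X\<close>, \<open>S\<^sub>H\<^sub>Y\<close>, \<open>S\<^sub>X\<^sub>Y\<close>, where all variances are scaled to 1. Solving the off-diagonal
  equations for the weight \<open>\<alpha>\<close> of the edge from \<open>X\<close> to \<open>Y\<close> gives
  \<open>\<alpha> (1 - p\<^sup>2) = 2 a p q + (b + c) (p q - r)\<close>, and \<open>a\<close>, \<open>b\<close>, \<open>c\<close> are negative. With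
  \<open>0 < p q < r\<close> the two summands have opposite signs and the ratio of \<open>b + c\<close> to \<open>a\<close> decides; with
  \<open>r < 0 < p q\<close> both are negative.\<close>

lemma confounding_partially_identifiable: "partially_identifiable confounding (X3, Y3)"
proof -
  let ?both = "vec3 (vec3 4 2 1) (vec3 2 4 1) (vec3 1 1 4) :: real^node3^node3"
  let ?neg = "vec3 (vec3 4 1 1) (vec3 1 4 (-1)) (vec3 1 (-1) 4) :: real^node3^node3"
  have 1: "?both \<in> M_plus confounding (X3, Y3)"
    unfolding sign_model_iff confounding_faithful
    by (intro conjI diagonally_dominant_imp_PD
        exI[of _ "vec3 (vec3 (-12) 0 0) (vec3 18 (-24) 0) (vec3 7 4 (-24))"])
      (simp_all add: node_simps confounding_def)
  have 2: "?both \<in> M_minus confounding (X3, Y3)"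
    unfolding sign_model_iff confounding_faithful
    by (intro conjI diagonally_dominant_imp_PD
        exI[of _ "vec3 (vec3 (-24) 0 0) (vec3 18 (-12) 0) (vec3 11 (-4) (-12))"])
      (simp_all add: node_simps confounding_def)
  have 3: "?neg \<in> M_minus confounding (X3, Y3)"
    unfolding sign_model_iff confounding_faithful
    by (intro conjI diagonally_dominant_imp_PD
        exI[of _ "vec3 (vec3 (-10) 0 0) (vec3 5 (-10) 0) (vec3 7 (-8) (-10))"])
      (simp_all add: node_simps confounding_def)
  have 4: "?neg \<notin> M_plus confounding (X3, Y3)"
  proof
    assume "?neg \<in> M_plus confounding (X3, Y3)"
    then obtain A :: "real^node3^node3"
      where off: "\<forall>i j. i \<noteq> j \<longrightarrow> (A ** ?neg) $ i $ j + (A ** ?neg) $ j $ i = 0"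
        and diag: "\<forall>i. (A ** ?neg) $ i $ i < 0"
        and supp: "\<forall>i j. A $ i $ j = 0 \<longleftrightarrow> (j, i) \<notin> confounding"
        and pos: "A $ Y3 $ X3 > 0"
      unfolding sign_model_iff by (auto simp: sgn_1_pos)
    have "A $ H3 $ X3 = 0" "A $ H3 $ Y3 = 0" "A $ X3 $ Y3 = 0"
      using supp by (simp_all add: confounding_def)
    with off diag pos show False
      \<comment> \<open>For a numerical covariance matrix all conditions on \<open>A\<close> are linear.\<close>
      by (simp add: node_simps)
  qed
  from 1 2 3 4 show ?thesis unfolding partially_identifiable_def by blast
qed

lemma cycle3_faithful:
  "S \<in> faithful_cov cycle3 \<longleftrightarrow> S \<in> PD \<and> (\<forall>i j. S $ i $ j \<noteq> 0)"
proof (rule faithful_cov_rooted)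
  have "H3 \<in> An cycle3 H3" "An cycle3 H3 \<subseteq> An cycle3 Y3" "An cycle3 Y3 \<subseteq> An cycle3 X3"
    by (auto intro!: parent_is_ancestor ancestor_of_parent simp: cycle3_def)
  then show "H3 \<in> An cycle3 v" for v by (cases v) auto
qed

text \<open>In the same notation, but with \<open>\<alpha>\<close> the weight of the edge from \<open>H\<close> to \<open>Y\<close>, the off-diagonal
  equations give \<open>\<alpha> (1 + p q r) = a (p r - q) + b r (p - q r) - c q (1 + r\<^sup>2)\<close>. For small positive
  \<open>q < p r\<close> the first two coefficients are positive and the third is negative, so the ratio of the
  self-loop weights decides. For \<open>p, q > 0 > r\<close> all three coefficients are negative. The self-loop
  weights need not be negative on a cycle, so in this case the inequalities on the diagonal of
  \<open>A ** S\<close> have to be used as well to exclude \<open>\<alpha> < 0\<close>.\<close>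

lemma cycle3_partially_identifiable: "partially_identifiable cycle3 (H3, Y3)"
proof -
  let ?both = "vec3 (vec3 8 4 1) (vec3 4 8 3) (vec3 1 3 8) :: real^node3^node3"
  let ?pos = "vec3 (vec3 3 1 1) (vec3 1 3 (-1)) (vec3 1 (-1) 3) :: real^node3^node3"
  have 1: "?both \<in> M_plus cycle3 (H3, Y3)"
    unfolding sign_model_iff cycle3_faithful
    by (intro conjI diagonally_dominant_imp_PD
        exI[of _ "vec3 (vec3 (-1) 1 0) (vec3 0 (-2) 4) (vec3 1 0 (-10))"])
      (simp_all add: node_simps cycle3_def)
  have 2: "?both \<in> M_minus cycle3 (H3, Y3)"
    unfolding sign_model_iff cycle3_faithful
    by (intro conjI diagonally_dominant_imp_PD
        exI[of _ "vec3 (vec3 (-12) 10 0) (vec3 0 (-10) 8) (vec3 (-1) 0 (-10))"])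
      (simp_all add: node_simps cycle3_def)
  have 3: "?pos \<in> M_plus cycle3 (H3, Y3)"
    unfolding sign_model_iff cycle3_faithful
    by (intro conjI diagonally_dominant_imp_PD
        exI[of _ "vec3 (vec3 (-1) 1 0) (vec3 0 (-1) (-1)) (vec3 1 0 (-1))"])
      (simp_all add: node_simps cycle3_def)
  have 4: "?pos \<notin> M_minus cycle3 (H3, Y3)"
  proof
    assume "?pos \<in> M_minus cycle3 (H3, Y3)"
    then obtain A :: "real^node3^node3"
      where off: "\<forall>i j. i \<noteq> j \<longrightarrow> (A ** ?pos) $ i $ j + (A ** ?pos) $ j $ i = 0"
        and diag: "\<forall>i. (A ** ?pos) $ i $ i < 0"
        and supp: "\<forall>i j. A $ i $ j = 0 \<longleftrightarrow> (j, i) \<notin> cycle3"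
        and neg: "A $ Y3 $ H3 < 0"
      unfolding sign_model_iff by (auto simp: sgn_1_neg)
    have "A $ H3 $ Y3 = 0" "A $ X3 $ H3 = 0" "A $ Y3 $ X3 = 0"
      using supp by (simp_all add: cycle3_def)
    with off diag neg show False
      \<comment> \<open>For a numerical covariance matrix all conditions on \<open>A\<close> are linear.\<close>
      by (simp add: node_simps)
  qed
  from 1 2 3 4 show ?thesis unfolding partially_identifiable_def by blast
qed

section \<open>The six graphs\<close>

theorem theorem4p6:
  shows "identifiable cause_effect (H2, Y2)
    \<and> identifiable chain (X3, Y3)
    \<and> partially_identifiable confounding (X3, Y3)
    \<and> partially_identifiable cycle3 (H3, Y3)
    \<and> identifiable instrumental (X4, Y4)
    \<and> identifiable cycle_instrumental (X4, Y4)"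
  using cause_effect_identifiable chain_identifiable confounding_partially_identifiable
    cycle3_partially_identifiable instrumental_identifiable cycle_instrumental_identifiable
  by blast

end
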